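(* Let $0<\alpha<1$, $c_1,c_2>0$ and $C>0$ be constants and let $k\ge 1$ be an integer constant (none of these depends on $n$), such that $$C\le \frac{1}{10c_2}\qquad\text{and}\qquad \alpha\le \min\left(\frac78,\left(\frac{Cc_1}{8}\right)^{k+1}\right).$$ For each $n$ put $p=p(n)=Cn^{-\frac{k}{k+1}}$. Then there exist a constant $\theta>0$ and an integer $n_0$, neither depending on $n$, such that for every $n\ge n_0$ and every edge probability assignment $\{p(u,v)\}_{1\le u<v\le n}$ that is $(\alpha,c_1,c_2,p)$-good, the random graph $G$ on $\{1,\dots,n\}$ with these edge probabilities satisfies $$\mathbb{P}(E_{HAM})\ \ge\ 1-e^{-\theta np},$$ where $E_{HAM}$ is the event that $G$ contains a Hamiltonian path.
   Context: Random graph: let $K_n$ be the complete graph on the vertex set $\{1,\dots,n\}$. An edge probability assignment is a family of numbers $p(u,v)\in[0,1]$, $1\le u<v\le n$, extended symmetrically by $p(v,u)=p(u,v)$. Let $\{Z(f)\}_{f\in K_n}$ be independent random variables indexed by the edges of $K_n$, where for $f=(u,v)$ we have $\mathbb{P}(Z(f)=1)=p(u,v)=1-\mathbb{P}(Z(f)=0)$. The random graph $G$ has vertex set $\{1,\dots,n\}$ and consists of all edges $f$ with $Z(f)=1$. Good assignments: for constants $0<\alpha<1$, $c_1,c_2>0$ and $0<p=p(n)<1$, the assignment $\{p(u,v)\}_{1\le u<v\le n}$ is $(\alpha,c_1,c_2,p)$-good if for any vertex $u$ and any set $S\subseteq\{1,\dots,n\}\setminus\{u\}$ containing $r\ge\alpha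 n$ vertices ($r\ge1$), $$c_1 r p\ \le\ \sum_{v\in S}p(u,v)\ \le\ c_2 r p.$$ Hamiltonian path: a path in $G$ is a sequence of distinct vertices $(u_1,\dots,u_t)$ with $u_i$ adjacent to $u_{i+1}$ in $G$ for $1\le i\le t-1$; its length is $t-1$. It is Hamiltonian if its length is $n-1$, i.e. it visits every vertex. *)

theory Defs
  imports "HOL-Probability.Probability"
begin

definition complete_edges :: "nat \<Rightarrow> (nat \<times> nat) set" where
  "complete_edges n = {(u, v). 1 \<le> u \<and> u < v \<and> v \<le> n}"

lemma finite_complete_edges: "finite (complete_edges n)"
  by (rule finite_subset [of _ "{1..n} \<times> {1..n}"]) (auto simp: complete_edges_def)

definition edge_prob_assignment :: "nat \<Rightarrow> (nat \<Rightarrow> nat \<Rightarrow> real) \<Rightarrow> bool" where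
  "edge_prob_assignment n p \<longleftrightarrow>
     (\<forall>u\<in>{1..n}. \<forall>v\<in>{1..n}. u \<noteq> v \<longrightarrow> 0 \<le> p u v \<and> p u v \<le> 1 \<and> p v u = p u v)"

definition good_assignment ::
    "nat \<Rightarrow> real \<Rightarrow> real \<Rightarrow> real \<Rightarrow> real \<Rightarrow> (nat \<Rightarrow> nat \<Rightarrow> real) \<Rightarrow> bool" where
  "good_assignment n \<alpha> c1 c2 q p \<longleftrightarrow>
     (\<forall>u\<in>{1..n}. \<forall>S. S \<subseteq> {1..n} - {u} \<and> real (card S) \<ge> \<alpha> * real n \<and> card S \<ge> 1 \<longrightarrow>
        c1 * real (card S) * q \<le> (\<Sum>v\<in>S. p u v) \<and>
        (\<Sum>v\<in>S. p u v) \<le> c2 * real (card S) * q)"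

text \<open>
  The joint law of the independent indicators \<open>Z (u, v)\<close>, \<open>(u, v) \<in> complete_edges n\<close>:
  the coordinates are independent by \<open>indep_vars_Pi_pmf\<close>, and each is Bernoulli distributed
  by \<open>Pi_pmf_component\<close>. The value \<open>True\<close> stands for 1; indices outside
  \<open>complete_edges n\<close> get the dummy value \<open>False\<close>. Note that \<^const>\<open>bernoulli_pmf\<close> clamps
  parameters outside \<open>{0..1}\<close>, which \<^const>\<open>edge_prob_assignment\<close> excludes.
\<close>

definition edge_indicators :: "nat \<Rightarrow> (nat \<Rightarrow> nat \<Rightarrow> real) \<Rightarrow> (nat \<times> nat \<Rightarrow> bool) pmf" where
  "edge_indicators n p =
     Pi_pmf (complete_edges n) False (\<lambda>(u, v). bernoulli_pmf (p u v))"

definition graph_edges :: "nat \<Rightarrow> (nat \<times> nat \<Rightarrow> bool) \<Rightarrow> nat set set" where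
  "graph_edges n Z = {{u, v} |u v. (u, v) \<in> complete_edges n \<and> Z (u, v)}"

definition is_path :: "nat \<Rightarrow> nat set set \<Rightarrow> nat list \<Rightarrow> bool" where
  "is_path n E us \<longleftrightarrow> us \<noteq> [] \<and> set us \<subseteq> {1..n} \<and> distinct us \<and>
     (\<forall>i. Suc i < length us \<longrightarrow> {us ! i, us ! Suc i} \<in> E)"

definition path_length :: "nat list \<Rightarrow> nat" where
  "path_length us = length us - 1"

definition is_hamiltonian_path :: "nat \<Rightarrow> nat set set \<Rightarrow> nat list \<Rightarrow> bool" where
  "is_hamiltonian_path n E us \<longleftrightarrow> is_path n E us \<and> path_length us = n - 1"

definition E_HAM :: "nat \<Rightarrow> (nat \<times> nat \<Rightarrow> bool) set" where
  "E_HAM n = {Z. \<exists>us. is_hamiltonian_path n (graph_edges n Z) us}"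

end

theory Submission
  imports Defs
begin

text \<open>
  The argument is Posa's. Put \<open>q = pn n\<close>, so that \<open>n q = C n powr (1 / (k + 1))\<close> grows like a
  power of \<open>n\<close> and beats every multiple of \<open>ln n\<close>.

  If \<open>G\<close> has no Hamiltonian path, a longest path of \<open>G\<close> misses some vertex \<open>v\<close>, and its length
  is then also the maximal length of a path in \<open>G - v\<close>. Hence \<open>v\<close> is not adjacent to any vertex
  in which some longest path of \<open>G - v\<close> ends. Rotating one longest path of \<open>G - v\<close> about
  its fixed starting point yields a whole set \<open>U\<close> of such ends, and this set expands
  poorly: fewer than \<open>2 \<bar>U\<bar>\<close> vertices of \<open>G - v\<close> outside \<open>U\<close> have a neighbour in \<open>U\<close>
  (\<open>posa_rotation\<close>). So one of two unlikely things has happened (\<open>non_hamiltonian_cases\<close>).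

  \<^item> \<open>U\<close> has \<open>a \<le> n / 4\<close> elements. Together with \<open>v\<close> and its neighbours, it lies in a set \<open>W\<close>
    of \<open>3 a\<close> vertices, and there is no edge from \<open>U\<close> to the at least \<open>n / 4\<close> vertices
    outside \<open>W\<close>. A good assignment gives \<open>U\<close> and the complement of \<open>W\<close> at least
    \<open>c1 a (n / 4) q\<close> expected edges, so for fixed sets this has probability at most
    \<open>exp (- c1 a n q / 4)\<close>. There are at most \<open>n\<^sup>4\<^sup>a\<close> pairs of sets, and the exponential wins.

  \<^item> \<open>U\<close> has at least \<open>n / 4\<close> elements. It is a function of \<open>G - v\<close>, hence independent of the
    edges at \<open>v\<close>; conditionally on \<open>G - v\<close>, all edges from \<open>v\<close> to \<open>U\<close> are missing with probability
    at most \<open>exp (- c1 n q / 4)\<close> (\<open>prob_no_edge_to_revealed_set_le\<close>).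

  Goodness only speaks about sets of at least \<open>\<alpha> n\<close> vertices, so the argument needs
  \<open>\<alpha> \<le> 1 / 4\<close>. This is what the bounds on \<open>C\<close> and \<open>\<alpha>\<close> provide: goodness with respect to the
  set of all vertices but one forces \<open>c1 \<le> c2\<close>, so \<open>C c1 \<le> 1 / 10\<close>.
\<close>

section \<open>Paths and consecutive vertices\<close>

definition path_in :: "'a set \<Rightarrow> 'a set set \<Rightarrow> 'a list \<Rightarrow> bool" where
  "path_in V E us \<longleftrightarrow>
     us \<noteq> [] \<and> set us \<subseteq> V \<and> distinct us \<and> successively (\<lambda>a b. {a, b} \<in> E) us"

definition longest_path_in :: "'a set \<Rightarrow> 'a set set \<Rightarrow> 'a list \<Rightarrow> bool" where
  "longest_path_in V E us \<longleftrightarrow>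
     path_in V E us \<and> (\<forall>vs. path_in V E vs \<longrightarrow> length vs \<le> length us)"

text \<open>
  Consecutive entries are kept as an ordered pair. For a path with distinct vertices this makes
  successor and predecessor partial functions, which is what bounds the number of neighbours in
  Posa's lemma.
\<close>

fun consecutive :: "'a list \<Rightarrow> 'a \<Rightarrow> 'a \<Rightarrow> bool" where
  "consecutive [] a b \<longleftrightarrow> False"
| "consecutive (x # xs) a b \<longleftrightarrow> (xs \<noteq> [] \<and> a = x \<and> b = hd xs) \<or> consecutive xs a b"

lemma consecutive_append:
  "consecutive (xs @ ys) a b \<longleftrightarrow>
     consecutive xs a b \<or> consecutive ys a b \<or> (xs \<noteq> [] \<and> ys \<noteq> [] \<and> a = last xs \<and> b = hd ys)"
  by (induction xs) auto

lemma consecutive_rev: "consecutive (rev xs) a b \<longleftrightarrow> consecutive xs b a"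
  by (induction xs) (auto simp: consecutive_append last_rev)

lemma consecutive_in_set:
  assumes "consecutive xs a b"
  shows "a \<in> set xs" "b \<in> set xs"
  using assms by (induction xs) auto

lemma consecutive_succ_unique:
  assumes "distinct xs" "consecutive xs a b" "consecutive xs a c"
  shows "b = c"
  using assms by (induction xs) (auto dest: consecutive_in_set)

lemma consecutive_pred_unique:
  assumes "distinct xs" "consecutive xs b a" "consecutive xs c a"
  shows "b = c"
  using consecutive_succ_unique[of "rev xs" a b c] assms by (simp add: consecutive_rev)

lemma consecutive_not_last:
  assumes "distinct xs" "consecutive xs a b"
  shows "a \<noteq> last xs"
  using assms by (induction xs) (auto dest: consecutive_in_set)

lemma ex_consecutive_succ:
  assumes "a \<in> set xs" "a \<noteq> last xs"
  shows "\<exists>b. consecutive xs a b"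
  using assms
proof (induction xs)
  case (Cons x xs)
  show ?case
  proof (cases "xs \<noteq> [] \<and> a = x")
    case True
    hence "consecutive (x # xs) a (hd xs)" by simp
    thus ?thesis by blast
  next
    case False
    with Cons.prems have "a \<in> set xs" "a \<noteq> last xs"
      by (auto split: if_splits)
    then obtain b where "consecutive xs a b"
      using Cons.IH by blast
    hence "consecutive (x # xs) a b" by simp
    thus ?thesis by blast
  qed
qed simp

lemma ex_consecutive_pred:
  assumes "a \<in> set xs" "a \<noteq> hd xs"
  shows "\<exists>b. consecutive xs b a"
  using ex_consecutive_succ[of a "rev xs"] assms by (simp add: consecutive_rev last_rev)

section \<open>Posa rotations\<close>

text \<open>
  An edge from the last vertex of a path to an earlier vertex \<open>y\<close> allows the part behind \<open>y\<close> to be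
  traversed backwards, which gives a path on the same vertices with the same first vertex. The only
  edge that may be lost is the one from \<open>y\<close> to \<open>hd zs\<close>, and \<open>hd zs\<close> is the new last vertex.
\<close>

inductive rotated :: "'a set set \<Rightarrow> 'a list \<Rightarrow> 'a list \<Rightarrow> bool" for E P where
  rotated_refl: "rotated E P P"
| rotated_step: "rotated E P (xs @ y # zs) \<Longrightarrow> zs \<noteq> [] \<Longrightarrow> {last zs, y} \<in> E \<Longrightarrow>
           rotated E P (xs @ y # rev zs)"

definition rotation_ends :: "'a set set \<Rightarrow> 'a list \<Rightarrow> 'a set" where
  "rotation_ends E P = last ` {Q. rotated E P Q}"

lemma rotated_path:
  assumes "rotated E P Q" "path_in V E P"
  shows "path_in V E Q \<and> set Q = set P \<and> hd Q = hd P \<and> length Q = length P"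
  using assms
proof induction
  case (rotated_step xs y zs)
  have "(\<lambda>a b. {b, a} \<in> E) = (\<lambda>a b. {a, b} \<in> E)"
    by (simp add: insert_commute)
  with rotated_step show ?case
    by (auto simp: path_in_def successively_append_iff successively_Cons hd_rev last_rev
        insert_commute hd_append)
qed simp

text \<open>
  Each rotation destroys at most one edge of the current path, and this edge contains the new end
  vertex. So edges of the initial path that avoid all rotation ends are never destroyed.
\<close>

lemma consecutive_rotated:
  assumes "rotated E P Q" "consecutive P a b" "a \<notin> rotation_ends E P" "b \<notin> rotation_ends E P"
  shows "consecutive Q a b \<or> consecutive Q b a"
  using assms(1)
proof induction
  case rotated_refl
  then show ?case using assms(2) by simp
next
  case (rotated_step xs y zs)
  have "rotated E P (xs @ y # rev zs)"
    using rotated_step.hyps by (rule rotated.rotated_step)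
  hence "last (xs @ y # rev zs) \<in> rotation_ends E P"
    unfolding rotation_ends_def by blast
  hence "hd zs \<in> rotation_ends E P"
    using \<open>zs \<noteq> []\<close> by (simp add: last_rev)
  hence "hd zs \<noteq> a" "hd zs \<noteq> b"
    using assms(3,4) by auto
  with rotated_step show ?case
    by (auto simp: consecutive_append consecutive_rev)
qed

text \<open>
  The heart of Posa's lemma. A neighbour \<open>y\<close> of the end \<open>u\<close> of a rotated path \<open>Q\<close> lies on \<open>Q\<close>
  by maximality, and the rotation at \<open>y\<close> makes the successor of \<open>y\<close> in \<open>Q\<close> an end. If no
  neighbour of \<open>y\<close> in \<open>P\<close> were an end, \<open>y\<close> would have the same neighbours in \<open>Q\<close> as in
  \<open>P\<close>, and that successor would be one of them.
\<close>

lemma neighbour_of_rotation_end: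
  assumes P: "longest_path_in V E P"
    and y: "y \<in> V" "y \<notin> rotation_ends E P"
    and u: "u \<in> rotation_ends E P" "{u, y} \<in> E"
  shows "\<exists>w\<in>rotation_ends E P. consecutive P w y \<or> consecutive P y w"
proof (rule ccontr)
  let ?U = "rotation_ends E P"
  assume no: "\<not> ?thesis"
  obtain Q where Q: "rotated E P Q" "u = last Q"
    using u(1) by (auto simp: rotation_ends_def)
  have path: "path_in V E P"
    using P by (simp add: longest_path_in_def)
  note Qp = rotated_path[OF Q(1) path]
  have distP: "distinct P" and distQ: "distinct Q" and "Q \<noteq> []"
    using path Qp by (auto simp: path_in_def)
  have yQ: "y \<in> set Q"
  proof (rule ccontr)
    assume "y \<notin> set Q"
    hence "path_in V E (Q @ [y])"
      using Qp y u Q(2) by (auto simp: path_in_def successively_append_iff)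
    hence "length (Q @ [y]) \<le> length P"
      using P unfolding longest_path_in_def by blast
    thus False using Qp by simp
  qed
  have "last P \<in> ?U"
    unfolding rotation_ends_def using rotated_refl by blast
  hence y_last: "y \<noteq> last P" using y(2) by auto
  obtain xs zs where split: "Q = xs @ y # zs"
    using yQ by (auto dest: split_list)
  have "zs \<noteq> []"
    using split Q(2) u(1) y(2) by auto
  have "{last zs, y} \<in> E"
    using u(2) Q(2) split \<open>zs \<noteq> []\<close> by simp
  with Q(1) split \<open>zs \<noteq> []\<close> have "rotated E P (xs @ y # rev zs)"
    by (auto intro: rotated_step)
  hence "last (xs @ y # rev zs) \<in> ?U"
    unfolding rotation_ends_def by blast
  hence hdU: "hd zs \<in> ?U"
    using \<open>zs \<noteq> []\<close> by (simp add: last_rev)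
  have succQ: "consecutive Q y (hd zs)"
    using split \<open>zs \<noteq> []\<close> by (simp add: consecutive_append)
  have keep: "consecutive Q a y \<or> consecutive Q y a" if "consecutive P a y \<or> consecutive P y a" for a
    using that no consecutive_rotated[OF Q(1)] y(2) by blast
  have not_succ: "\<not> consecutive Q y a" if "consecutive P a y \<or> consecutive P y a" for a
  proof
    assume "consecutive Q y a"
    hence "a = hd zs"
      using consecutive_succ_unique[OF distQ] succQ by blast
    thus False using hdU no that by blast
  qed
  \<comment> \<open>Every \<open>P\<close>-neighbour of \<open>y\<close> precedes \<open>y\<close> in \<open>Q\<close>, since the successor of \<open>y\<close> in \<open>Q\<close> is an
    end. In particular \<open>y\<close> is not the first vertex, so it has two distinct \<open>P\<close>-neighbours, which is
    one too many.\<close>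
  obtain s where s: "consecutive P y s"
    using ex_consecutive_succ[of y P] yQ Qp y_last by auto
  hence s': "consecutive Q s y"
    using keep not_succ by blast
  have "y \<noteq> hd Q"
    using consecutive_not_last[of "rev Q" y s] s' distQ by (simp add: consecutive_rev last_rev \<open>Q \<noteq> []\<close>)
  hence "y \<noteq> hd P" using Qp by simp
  then obtain r where r: "consecutive P r y"
    using ex_consecutive_pred[of y P] yQ Qp by auto
  hence "consecutive Q r y"
    using keep not_succ by blast
  hence "r = s"
    using s' consecutive_pred_unique[OF distQ] by blast
  with r s distP show False
  proof (induction P)
    case (Cons x P) 
    then show ?case by (auto dest: consecutive_in_set)
  qed simp
qed

text \<open>
  By the previous lemma, outside neighbours of the set of ends are successors or predecessors of
  ends on the initial path. The last vertex of that path is an end without successor, which makes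
  the inequality strict; \<open>non_hamiltonian_cases\<close> uses this to fit one more vertex into a set of size
  \<open>3 * card U\<close>.
\<close>

theorem posa_rotation:
  assumes P: "longest_path_in V E P" and fin: "finite V"
  obtains U where "U \<subseteq> V" "U \<noteq> {}"
    "\<And>u. u \<in> U \<Longrightarrow> \<exists>Q. longest_path_in V E Q \<and> last Q = u"
    "card {y \<in> V - U. \<exists>u\<in>U. {u, y} \<in> E} < 2 * card U"
proof
  let ?U = "rotation_ends E P"
  have path: "path_in V E P"
    using P by (simp add: longest_path_in_def)
  hence distP: "distinct P" by (simp add: path_in_def)
  have lastP: "last P \<in> ?U"
    unfolding rotation_ends_def using rotated_refl by blast
  show ends: "\<exists>Q. longest_path_in V E Q \<and> last Q = u" if u: "u \<in> ?U" for u
  proof -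
    obtain Q where "rotated E P Q" "last Q = u"
      using u by (auto simp: rotation_ends_def)
    thus ?thesis
      using rotated_path[OF _ path, of Q] P by (auto simp: longest_path_in_def)
  qed
  show sub: "?U \<subseteq> V"
    using ends by (force simp: longest_path_in_def path_in_def)
  show "?U \<noteq> {}" using lastP by blast
  have finU: "finite ?U" using sub fin finite_subset by blast
  define succ where "succ w = (THE y. consecutive P w y)" for w
  define pred where "pred w = (THE y. consecutive P y w)" for w
  have succ: "succ w = y" if "consecutive P w y" for w y
    unfolding succ_def using that consecutive_succ_unique[OF distP] by blast
  have pred: "pred w = y" if "consecutive P y w" for w y
    unfolding pred_def using that consecutive_pred_unique[OF distP] by blast
  have "{y \<in> V - ?U. \<exists>u\<in>?U. {u, y} \<in> E} \<subseteq> succ ` (?U - {last P}) \<union> pred ` ?U"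
  proof
    fix y assume "y \<in> {y \<in> V - ?U. \<exists>u\<in>?U. {u, y} \<in> E}"
    then obtain u where "y \<in> V" "y \<notin> ?U" "u \<in> ?U" "{u, y} \<in> E"
      by auto
    from neighbour_of_rotation_end[OF P this]
    obtain w where w: "w \<in> ?U" "consecutive P w y \<or> consecutive P y w" ..
    from w(2) show "y \<in> succ ` (?U - {last P}) \<union> pred ` ?U"
    proof
      assume "consecutive P w y"
      with succ consecutive_not_last[OF distP] w(1) show ?thesis by force
    next
      assume "consecutive P y w"
      with pred w(1) show ?thesis by force
    qed
  qed
  hence "card {y \<in> V - ?U. \<exists>u\<in>?U. {u, y} \<in> E} \<le> card (succ ` (?U - {last P}) \<union> pred ` ?U)"
    using finU by (intro card_mono) auto
  also have "\<dots> \<le> card (succ ` (?U - {last P})) + card (pred ` ?U)"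
    by (rule card_Un_le)
  also have "\<dots> \<le> card (?U - {last P}) + card ?U"
    using finU by (intro add_mono card_image_le) auto
  also have "\<dots> < 2 * card ?U"
    using card_Diff1_less[OF finU lastP] by simp
  finally show "card {y \<in> V - ?U. \<exists>u\<in>?U. {u, y} \<in> E} < 2 * card ?U" .
qed

lemma ex_longest_path_in:
  assumes "finite V" "V \<noteq> {}"
  shows "\<exists>P. longest_path_in V E P"
proof -
  obtain v where "path_in V E [v]"
    using assms by (auto simp: path_in_def)
  moreover have "length P \<le> card V" if "path_in V E P" for P
    using that assms card_mono[of V "set P"] by (auto simp: path_in_def distinct_card)
  ultimately show ?thesis
    unfolding longest_path_in_def
    using ex_has_greatest_nat[of "path_in V E" "[v]" length "Suc (card V)"] le_imp_less_Suc by blast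
qed

text \<open>
  Fixing one choice of the set for every graph turns it into a function of the graph. The
  probabilistic argument needs this, as it reveals \<open>G - v\<close> and then treats the set as known.
\<close>

definition posa_set :: "'a set \<Rightarrow> 'a set set \<Rightarrow> 'a set" where
  "posa_set V E = (SOME U. U \<subseteq> V \<and> U \<noteq> {} \<and>
     (\<forall>u\<in>U. \<exists>Q. longest_path_in V E Q \<and> last Q = u) \<and>
     card {y \<in> V - U. \<exists>u\<in>U. {u, y} \<in> E} < 2 * card U)"

lemma posa_set:
  assumes "finite V" "V \<noteq> {}"
  shows "posa_set V E \<subseteq> V" "posa_set V E \<noteq> {}"
    "\<And>u. u \<in> posa_set V E \<Longrightarrow> \<exists>Q. longest_path_in V E Q \<and> last Q = u"
    "card {y \<in> V - posa_set V E. \<exists>u\<in>posa_set V E. {u, y} \<in> E} < 2 * card (posa_set V E)"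
proof -
  obtain P where "longest_path_in V E P"
    using ex_longest_path_in[OF assms] by blast
  then obtain U where U: "U \<subseteq> V" "U \<noteq> {}"
    "\<And>u. u \<in> U \<Longrightarrow> \<exists>Q. longest_path_in V E Q \<and> last Q = u"
    "card {y \<in> V - U. \<exists>u\<in>U. {u, y} \<in> E} < 2 * card U"
    using posa_rotation[OF _ assms(1)] by blast
  have "\<exists>U. U \<subseteq> V \<and> U \<noteq> {} \<and>
     (\<forall>u\<in>U. \<exists>Q. longest_path_in V E Q \<and> last Q = u) \<and>
     card {y \<in> V - U. \<exists>u\<in>U. {u, y} \<in> E} < 2 * card U"
    using U by (intro exI[of _ U]) blast
  from someI_ex[OF this, folded posa_set_def]
  show "posa_set V E \<subseteq> V" "posa_set V E \<noteq> {}"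
    "\<And>u. u \<in> posa_set V E \<Longrightarrow> \<exists>Q. longest_path_in V E Q \<and> last Q = u"
    "card {y \<in> V - posa_set V E. \<exists>u\<in>posa_set V E. {u, y} \<in> E} < 2 * card (posa_set V E)"
    by blast+
qed

lemma path_in_delete_vertex:
  "path_in (V - {v}) {e \<in> E. v \<notin> e} P \<longleftrightarrow> path_in V E P \<and> v \<notin> set P"
proof -
  have "successively (\<lambda>a b. {a, b} \<in> {e \<in> E. v \<notin> e}) P \<longleftrightarrow> successively (\<lambda>a b. {a, b} \<in> E) P"
    if "v \<notin> set P"
    using that by (intro successively_cong) auto
  thus ?thesis
    unfolding path_in_def by blast
qed

text \<open>
  Take \<open>v\<close> off a longest path \<open>P\<close>. As \<open>P\<close> survives the deletion of \<open>v\<close>, longest paths of the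
  smaller graph are as long as \<open>P\<close>, and an edge from an end of one of them to \<open>v\<close> would yield a path
  longer than \<open>P\<close>.
\<close>

lemma missed_vertex_not_adjacent_posa_set:
  assumes "finite V" "V \<noteq> {}" and noham: "\<And>P. path_in V E P \<Longrightarrow> set P \<noteq> V"
  obtains v where "v \<in> V" "V - {v} \<noteq> {}"
    "\<And>u. u \<in> posa_set (V - {v}) {e \<in> E. v \<notin> e} \<Longrightarrow> {u, v} \<notin> E"
proof -
  obtain P where P: "longest_path_in V E P"
    using ex_longest_path_in assms(1,2) by blast
  hence pathP: "path_in V E P" by (simp add: longest_path_in_def)
  with noham obtain v where v: "v \<in> V" "v \<notin> set P"
    unfolding path_in_def by blast
  let ?E = "{e \<in> E. v \<notin> e}"
  have ne: "V - {v} \<noteq> {}"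
    using pathP v by (auto simp: path_in_def dest: hd_in_set)
  have "{u, v} \<notin> E" if u: "u \<in> posa_set (V - {v}) ?E" for u
  proof
    assume "{u, v} \<in> E"
    obtain Q where Q: "longest_path_in (V - {v}) ?E Q" "last Q = u"
      using posa_set(3)[OF _ ne u] assms(1) by auto
    have "path_in (V - {v}) ?E P"
      using pathP v by (simp add: path_in_delete_vertex)
    hence "length P \<le> length Q"
      using Q(1) by (simp add: longest_path_in_def)
    moreover have "path_in V E Q" "v \<notin> set Q"
      using Q(1) path_in_delete_vertex[of V v E Q] by (auto simp: longest_path_in_def)
    hence "path_in V E (Q @ [v])"
      using \<open>{u, v} \<in> E\<close> Q(2) v by (auto simp: path_in_def successively_append_iff)
    hence "length (Q @ [v]) \<le> length P"
      using P by (auto simp: longest_path_in_def)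
    ultimately show False by simp
  qed
  with v(1) ne that show ?thesis by blast
qed

section \<open>Absence of independent Bernoulli events\<close>

lemma prob_Pi_bernoulli_none_le:
  assumes "finite D" "F \<subseteq> D" "\<And>e. e \<in> F \<Longrightarrow> 0 \<le> p e \<and> p e \<le> 1"
  shows "measure_pmf.prob (Pi_pmf D False (\<lambda>e. bernoulli_pmf (p e))) {f. \<forall>e\<in>F. \<not> f e}
           \<le> exp (- (\<Sum>e\<in>F. p e))"
proof -
  have finF: "finite F" using assms finite_subset by blast
  have "measure_pmf.prob (Pi_pmf D False (\<lambda>e. bernoulli_pmf (p e))) {f. \<forall>e\<in>F. \<not> f e}
      = measure_pmf.prob (Pi_pmf D False (\<lambda>e. bernoulli_pmf (p e)))
          (Pi D (\<lambda>e. if e \<in> F then {False} else UNIV))"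
    using assms(2) by (intro arg_cong[where f = "measure_pmf.prob _"]) (auto simp: Pi_def split: if_splits)
  also have "\<dots> = (\<Prod>e\<in>D. measure_pmf.prob (bernoulli_pmf (p e)) (if e \<in> F then {False} else UNIV))"
    by (rule measure_Pi_pmf_Pi) fact
  also have "\<dots> = (\<Prod>e\<in>F. measure_pmf.prob (bernoulli_pmf (p e)) {False})"
    using assms by (intro prod.mono_neutral_cong_right) auto
  also have "\<dots> = (\<Prod>e\<in>F. 1 - p e)"
    using assms(3) by (intro prod.cong) (auto simp: measure_pmf_single)
  also have "\<dots> \<le> (\<Prod>e\<in>F. exp (- p e))"
    using assms(3) exp_ge_add_one_self[of "- p _"] by (intro prod_mono) auto
  also have "\<dots> = exp (- (\<Sum>e\<in>F. p e))"
    using finF by (simp add: exp_sum flip: sum_negf)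
  finally show ?thesis .
qed

lemma prob_bind_pmf_le:
  assumes "\<And>x. x \<in> set_pmf M \<Longrightarrow> measure_pmf.prob (N x) A \<le> c" and "0 \<le> c"
  shows "measure_pmf.prob (bind_pmf M N) A \<le> c"
proof -
  have "emeasure (measure_pmf (bind_pmf M N)) A = (\<integral>\<^sup>+x. emeasure (measure_pmf (N x)) A \<partial>measure_pmf M)"
    by (simp add: emeasure_bind_pmf)
  also have "\<dots> \<le> (\<integral>\<^sup>+x. ennreal c \<partial>measure_pmf M)"
    using assms by (intro nn_integral_mono_AE) (auto simp: AE_measure_pmf_iff measure_pmf.emeasure_eq_measure)
  also have "\<dots> = ennreal c" by simp
  finally show ?thesis
    using assms(2) by (simp add: measure_pmf.emeasure_eq_measure)
qed

text \<open>
  The index set \<open>F f\<close> may be chosen after inspecting the coordinates outside \<open>D\<close>: conditionally on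
  these, it is a fixed subset of \<open>D\<close>, and the coordinates in \<open>D\<close> still have their original law. The
  lower bound \<open>s\<close> is part of the event because it need not hold for every outcome.
\<close>

lemma prob_Pi_bernoulli_adaptive_le:
  fixes F :: "('a \<Rightarrow> bool) \<Rightarrow> 'a set"
  assumes fin: "finite A" and D: "D \<subseteq> A"
    and p: "\<And>e. e \<in> D \<Longrightarrow> 0 \<le> p e \<and> p e \<le> 1"
    and F: "\<And>f. F f \<subseteq> D"
    and dep: "\<And>f g. (\<And>e. e \<notin> D \<Longrightarrow> f e = g e) \<Longrightarrow> F f = F g"
  shows "measure_pmf.prob (Pi_pmf A False (\<lambda>e. bernoulli_pmf (p e)))
            {f. s \<le> (\<Sum>e\<in>F f. p e) \<and> (\<forall>e\<in>F f. \<not> f e)} \<le> exp (- s)"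
proof -
  let ?B = "{f. s \<le> (\<Sum>e\<in>F f. p e) \<and> (\<forall>e\<in>F f. \<not> f e)}"
  let ?M = "\<lambda>X. Pi_pmf X False (\<lambda>e. bernoulli_pmf (p e))"
  \<comment> \<open>\<open>J g f\<close> glues the coordinates \<open>g\<close> outside \<open>D\<close>, drawn first, to the coordinates \<open>f\<close> in \<open>D\<close>.\<close>
  define J where "J = (\<lambda>g f x. if x \<in> A - D then g x else f x :: bool)"
  have "?M A = ?M ((A - D) \<union> D)"
    using D by (simp add: Un_absorb2)
  also have "\<dots> = map_pmf (\<lambda>(g, f). J g f) (pair_pmf (?M (A - D)) (?M D))"
    unfolding J_def using fin D by (subst Pi_pmf_union) (auto intro: finite_subset)
  also have "\<dots> = bind_pmf (?M (A - D)) (\<lambda>g. map_pmf (J g) (?M D))"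
    by (simp add: pair_pmf_def map_bind_pmf map_pmf_def bind_assoc_pmf bind_return_pmf)
  finally have split: "?M A = \<dots>" .
  have "measure_pmf.prob (map_pmf (J g) (?M D)) ?B \<le> exp (- s)" for g
  proof -
    define F0 where "F0 = F (J g (\<lambda>_. False))"
    have FJ: "F (J g f) = F0" if "f \<in> set_pmf (?M D)" for f
      unfolding F0_def
    proof (rule dep)
      fix e assume "e \<notin> D"
      moreover have "f e = False" if "e \<notin> D"
        using \<open>f \<in> set_pmf (?M D)\<close> that set_Pi_pmf_subset[of D False] fin D
        by (blast dest: finite_subset)
      ultimately show "J g f e = J g (\<lambda>_. False) e"
        by (auto simp: J_def)
    qed
    have "F0 \<subseteq> D" using F by (simp add: F0_def)
    have JF: "J g f e = f e" if "e \<in> F0" for f e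
      using that \<open>F0 \<subseteq> D\<close> by (auto simp: J_def)
    show ?thesis
    proof (cases "s \<le> (\<Sum>e\<in>F0. p e)")
      case True
      have "measure_pmf.prob (map_pmf (J g) (?M D)) ?B = measure_pmf.prob (?M D) (J g -` ?B)"
        by simp
      also have "\<dots> \<le> measure_pmf.prob (?M D) {f. \<forall>e\<in>F0. \<not> f e}"
        using FJ JF by (subst measure_Int_set_pmf [symmetric], intro measure_pmf.finite_measure_mono) auto
      also have "\<dots> \<le> exp (- (\<Sum>e\<in>F0. p e))"
        using fin D \<open>F0 \<subseteq> D\<close> p by (intro prob_Pi_bernoulli_none_le) (auto intro: finite_subset)
      also have "\<dots> \<le> exp (- s)" using True by simp
      finally show ?thesis .
    next
      case False
      have "measure_pmf.prob (map_pmf (J g) (?M D)) ?B = 0"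
        using False FJ by (auto simp: measure_pmf_zero_iff)
      thus ?thesis by simp
    qed
  qed
  thus ?thesis
    unfolding split by (intro prob_bind_pmf_le) auto
qed


section \<open>Missing edges in the random graph\<close>

text \<open>
  The indicators are indexed by ordered pairs with the smaller vertex first.
\<close>

definition pair_of :: "nat \<Rightarrow> nat \<Rightarrow> nat \<times> nat" where
  "pair_of u v = (min u v, max u v)"

definition crossing :: "nat set \<Rightarrow> nat set \<Rightarrow> (nat \<times> nat) set" where
  "crossing A B = (\<lambda>(u, v). pair_of u v) ` (A \<times> B)"

lemma crossing_subset:
  assumes "A \<subseteq> {1..n}" "B \<subseteq> {1..n}" "A \<inter> B = {}"
  shows "crossing A B \<subseteq> complete_edges n"
proof -
  have "pair_of u v \<in> complete_edges n" if "u \<in> A" "v \<in> B" for u v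
  proof -
    have "u \<noteq> v" "u \<in> {1..n}" "v \<in> {1..n}" using that assms by auto
    thus ?thesis by (auto simp: complete_edges_def pair_of_def min_def max_def)
  qed
  thus ?thesis by (auto simp: crossing_def)
qed

lemma graph_edges_iff:
  assumes "u \<in> {1..n}" "v \<in> {1..n}" "u \<noteq> v"
  shows "{u, v} \<in> graph_edges n Z \<longleftrightarrow> Z (pair_of u v)"
proof -
  have "{u, v} \<in> graph_edges n Z \<longleftrightarrow> Z (u, v)" if "u \<in> {1..n}" "v \<in> {1..n}" "u < v" for u v
    using that by (auto simp: graph_edges_def complete_edges_def doubleton_eq_iff)
  note this[of u v] this[of v u]
  with assms show ?thesis
    by (cases u v rule: linorder_cases) (auto simp: pair_of_def insert_commute)
qed

lemma no_crossing_iff: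
  assumes "A \<subseteq> {1..n}" "B \<subseteq> {1..n}" "A \<inter> B = {}"
  shows "(\<forall>e\<in>crossing A B. \<not> Z e) \<longleftrightarrow> (\<forall>u\<in>A. \<forall>v\<in>B. {u, v} \<notin> graph_edges n Z)"
proof -
  have "{u, v} \<in> graph_edges n Z \<longleftrightarrow> Z (pair_of u v)" if "u \<in> A" "v \<in> B" for u v
    using that assms by (intro graph_edges_iff) auto
  thus ?thesis by (auto simp: crossing_def)
qed

lemma sum_crossing:
  assumes "edge_prob_assignment n p" "A \<subseteq> {1..n}" "B \<subseteq> {1..n}" "A \<inter> B = {}"
  shows "(\<Sum>e\<in>crossing A B. case_prod p e) = (\<Sum>u\<in>A. \<Sum>v\<in>B. p u v)"
proof -
  have inj: "inj_on (\<lambda>(u, v). pair_of u v) (A \<times> B)"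
    using assms(4) by (force simp: inj_on_def pair_of_def min_def max_def split: if_splits)
  have "(\<Sum>e\<in>crossing A B. case_prod p e) = (\<Sum>(u, v)\<in>A \<times> B. case_prod p (pair_of u v))"
    unfolding crossing_def using inj by (subst sum.reindex) (auto intro!: sum.cong)
  also have "\<dots> = (\<Sum>(u, v)\<in>A \<times> B. p u v)"
  proof (rule sum.cong[OF refl], unfold split_paired_all prod.case)
    fix u v assume uv: "(u, v) \<in> A \<times> B"
    hence "u \<in> {1..n}" "v \<in> {1..n}" "u \<noteq> v" using assms by auto
    hence "p v u = p u v" using assms(1) by (simp add: edge_prob_assignment_def)
    thus "case_prod p (pair_of u v) = p u v"
      by (simp add: pair_of_def min_def max_def)
  qed
  also have "\<dots> = (\<Sum>u\<in>A. \<Sum>v\<in>B. p u v)"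
    by (simp add: sum.cartesian_product)
  finally show ?thesis .
qed

lemma good_assignment_sum_crossing_ge:
  assumes "edge_prob_assignment n p" "good_assignment n \<alpha> c1 c2 q p"
    and "A \<subseteq> {1..n}" "B \<subseteq> {1..n}" "A \<inter> B = {}" "\<alpha> * real n \<le> real (card B)" "B \<noteq> {}"
  shows "c1 * real (card A) * real (card B) * q \<le> (\<Sum>e\<in>crossing A B. case_prod p e)"
proof -
  have "finite B" using assms(4) finite_subset by blast
  hence "card B \<ge> 1" using assms(7) by (simp add: Suc_le_eq card_gt_0_iff)
  have "c1 * real (card B) * q \<le> (\<Sum>v\<in>B. p u v)" if "u \<in> A" for u
  proof -
    have "u \<in> {1..n}" "B \<subseteq> {1..n} - {u}" using that assms by auto
    thus ?thesis
      using assms(2,6) \<open>card B \<ge> 1\<close> unfolding good_assignment_def by blast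
  qed
  hence "(\<Sum>u\<in>A. c1 * real (card B) * q) \<le> (\<Sum>u\<in>A. \<Sum>v\<in>B. p u v)"
    by (rule sum_mono)
  thus ?thesis
    by (simp add: sum_crossing[OF assms(1,3-5)] mult_ac)
qed

lemma edge_indicators_eq:
  "edge_indicators n p = Pi_pmf (complete_edges n) False (\<lambda>e. bernoulli_pmf (case_prod p e))"
  unfolding edge_indicators_def by (rule arg_cong[where f = "Pi_pmf _ _"]) auto

lemma edge_prob_bounds:
  assumes "edge_prob_assignment n p" "e \<in> complete_edges n"
  shows "0 \<le> case_prod p e \<and> case_prod p e \<le> 1"
  using assms by (auto simp: edge_prob_assignment_def complete_edges_def)

lemma prob_no_edge_between_le:
  assumes "edge_prob_assignment n p" "good_assignment n \<alpha> c1 c2 q p"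
    and "A \<subseteq> {1..n}" "B \<subseteq> {1..n}" "A \<inter> B = {}" "\<alpha> * real n \<le> real (card B)" "B \<noteq> {}"
  shows "measure_pmf.prob (edge_indicators n p) {Z. \<forall>u\<in>A. \<forall>v\<in>B. {u, v} \<notin> graph_edges n Z}
           \<le> exp (- (c1 * real (card A) * real (card B) * q))"
proof -
  note sub = crossing_subset[OF assms(3-5)]
  have "measure_pmf.prob (edge_indicators n p) {Z. \<forall>u\<in>A. \<forall>v\<in>B. {u, v} \<notin> graph_edges n Z}
      = measure_pmf.prob (edge_indicators n p) {Z. \<forall>e\<in>crossing A B. \<not> Z e}"
    by (simp add: no_crossing_iff[OF assms(3-5)])
  also have "\<dots> \<le> exp (- (\<Sum>e\<in>crossing A B. case_prod p e))"
    unfolding edge_indicators_eq using sub edge_prob_bounds[OF assms(1)]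
    by (intro prob_Pi_bernoulli_none_le finite_complete_edges) auto
  also have "\<dots> \<le> exp (- (c1 * real (card A) * real (card B) * q))"
    using good_assignment_sum_crossing_ge[OF assms] by simp
  finally show ?thesis .
qed

text \<open>
  The set \<open>U\<close> depends only on the edges avoiding \<open>v\<close>, so revealing it leaves the edges at \<open>v\<close>
  random. Conditioning replaces a union bound over the possible values of \<open>U\<close>, which would fail when
  \<open>q\<close> tends to 0: there are exponentially many values, against a probability of \<open>exp (- c1 m q)\<close>.
\<close>

lemma prob_no_edge_to_revealed_set_le:
  fixes U :: "nat set set \<Rightarrow> nat set"
  assumes "edge_prob_assignment n p" "good_assignment n \<alpha> c1 c2 q p" "c1 > 0" "q > 0"
    and v: "v \<in> {1..n}" and U: "\<And>E. U E \<subseteq> {1..n} - {v}" and m: "\<alpha> * real n \<le> m" "0 < m"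
  shows "measure_pmf.prob (edge_indicators n p)
           {Z. m \<le> real (card (U {e \<in> graph_edges n Z. v \<notin> e})) \<and>
               (\<forall>u\<in>U {e \<in> graph_edges n Z. v \<notin> e}. {u, v} \<notin> graph_edges n Z)}
           \<le> exp (- (c1 * m * q))"
proof -
  define W where "W Z = U {e \<in> graph_edges n Z. v \<notin> e}" for Z
  define D where "D = crossing {v} ({1..n} - {v})"
  have W: "{v} \<subseteq> {1..n}" "W Z \<subseteq> {1..n}" "{v} \<inter> W Z = {}" for Z
    using v U by (auto simp: W_def)
  have D: "D \<subseteq> complete_edges n"
    unfolding D_def using v by (intro crossing_subset) auto
  have dep: "W f = W g" if eq: "\<And>e. e \<notin> D \<Longrightarrow> f e = g e" for f g
  proof -
    have "f (a, b) = g (a, b)" if "(a, b) \<in> complete_edges n" "v \<notin> {a, b}" for a b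
    proof (rule eq)
      show "(a, b) \<notin> D"
        using that by (auto simp: D_def crossing_def pair_of_def min_def max_def split: if_splits)
    qed
    hence "{e \<in> graph_edges n f. v \<notin> e} = {e \<in> graph_edges n g. v \<notin> e}"
      unfolding graph_edges_def by blast
    thus ?thesis by (simp add: W_def)
  qed
  have "measure_pmf.prob (edge_indicators n p)
          {Z. m \<le> real (card (W Z)) \<and> (\<forall>u\<in>W Z. {u, v} \<notin> graph_edges n Z)}
      \<le> measure_pmf.prob (edge_indicators n p)
          {Z. c1 * m * q \<le> (\<Sum>e\<in>crossing {v} (W Z). case_prod p e) \<and>
              (\<forall>e\<in>crossing {v} (W Z). \<not> Z e)}"
    (is "measure_pmf.prob _ ?L \<le> measure_pmf.prob _ ?R")
  proof (rule measure_pmf.finite_measure_mono)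
    show "?L \<subseteq> ?R"
    proof
      fix Z assume "Z \<in> ?L"
      hence Z: "m \<le> real (card (W Z))" "\<forall>u\<in>W Z. {u, v} \<notin> graph_edges n Z"
        by auto
      hence "W Z \<noteq> {}" using m(2) by auto
      hence "c1 * 1 * real (card (W Z)) * q \<le> (\<Sum>e\<in>crossing {v} (W Z). case_prod p e)"
        using good_assignment_sum_crossing_ge[OF assms(1,2) W(1) W(2,3)[of Z]] Z(1) m(1) by simp
      moreover have "c1 * m * q \<le> c1 * real (card (W Z)) * q"
        using assms(3,4) Z(1) by simp
      moreover have "\<forall>e\<in>crossing {v} (W Z). \<not> Z e"
        using Z(2) by (subst no_crossing_iff[OF W]) (auto simp: insert_commute)
      ultimately show "Z \<in> ?R" by auto
    qed
  qed simp
  also have "\<dots> \<le> exp (- (c1 * m * q))"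
    unfolding edge_indicators_eq
  proof (rule prob_Pi_bernoulli_adaptive_le[where D = D and F = "\<lambda>Z. crossing {v} (W Z)"])
    show "crossing {v} (W f) \<subseteq> D" for f
      using U[of "{e \<in> graph_edges n f. v \<notin> e}"]
      unfolding D_def crossing_def W_def by (intro image_mono Sigma_mono) auto
    show "0 \<le> case_prod p e \<and> case_prod p e \<le> 1" if "e \<in> D" for e
      using edge_prob_bounds[OF assms(1)] D that by blast
    show "crossing {v} (W f) = crossing {v} (W g)" if "\<And>e. e \<notin> D \<Longrightarrow> f e = g e" for f g
      using dep[of f g] that by simp
  qed (fact finite_complete_edges D)+
  finally show ?thesis by (simp add: W_def)
qed

section \<open>Graphs without Hamiltonian path\<close>

lemma E_HAM_iff:
  assumes "n \<ge> 1"
  shows "Z \<in> E_HAM n \<longleftrightarrow> (\<exists>P. path_in {1..n} (graph_edges n Z) P \<and> set P = {1..n})"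
proof -
  have "is_hamiltonian_path n E P \<longleftrightarrow> path_in {1..n} E P \<and> set P = {1..n}" for E P
  proof -
    have "is_path n E P \<longleftrightarrow> path_in {1..n} E P"
      by (auto simp: is_path_def path_in_def successively_conv_nth)
    moreover have "path_length P = n - 1 \<longleftrightarrow> set P = {1..n}" if "path_in {1..n} E P"
    proof -
      have P: "P \<noteq> []" "set P \<subseteq> {1..n}" "card (set P) = length P"
        using that by (auto simp: path_in_def distinct_card)
      have "path_length P = n - 1 \<longleftrightarrow> length P = n"
        using P(1) assms by (cases P) (auto simp: path_length_def)
      also have "\<dots> \<longleftrightarrow> set P = {1..n}"
        using P card_subset_eq[of "{1..n}" "set P"] by auto
      finally show ?thesis .
    qed
    ultimately show ?thesis by (auto simp: is_hamiltonian_path_def)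
  qed
  thus ?thesis by (simp add: E_HAM_def)
qed

definition expansion_pairs :: "nat \<Rightarrow> nat \<Rightarrow> (nat set \<times> nat set) set" where
  "expansion_pairs n a =
     {(A, W). A \<subseteq> W \<and> W \<subseteq> {1..n} \<and> card A = a \<and> card W = 3 * a}"

lemma finite_expansion_pairs: "finite (expansion_pairs n a)"
  by (rule finite_subset[of _ "Pow {1..n} \<times> Pow {1..n}"]) (auto simp: expansion_pairs_def)

lemma card_expansion_pairs_le:
  assumes "n \<ge> 1" "3 * a \<le> n" shows "card (expansion_pairs n a) \<le> n ^ (4 * a)"
proof -
  have "card (expansion_pairs n a) \<le>
      card ({A. A \<subseteq> {1..n} \<and> card A = a} \<times> {W. W \<subseteq> {1..n} \<and> card W = 3 * a})"
    by (rule card_mono) (auto simp: expansion_pairs_def)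
  also have "\<dots> = (n choose a) * (n choose (3 * a))"
    by (simp add: card_cartesian_product n_subsets)
  also have "\<dots> \<le> n ^ a * n ^ (3 * a)"
    using assms by (intro mult_mono binomial_le_pow) auto
  also have "\<dots> = n ^ (4 * a)" by (simp flip: power_add)
  finally show ?thesis .
qed

text \<open>
  If \<open>U\<close> is small, then \<open>v\<close>, \<open>U\<close> and the neighbours of \<open>U\<close> number at most
  \<open>1 + a + (2 a - 1) = 3 a\<close>. Padding their union to a set \<open>W\<close> of exactly \<open>3 a\<close> vertices keeps the
  number of pairs in the union bound polynomial of degree \<open>4 a\<close>.
\<close>

lemma non_hamiltonian_cases:
  assumes "n \<ge> 1" "Z \<notin> E_HAM n"
  defines "E \<equiv> graph_edges n Z"
  shows "(\<exists>a\<in>{1..n div 4}. \<exists>(A, W)\<in>expansion_pairs n a. \<forall>u\<in>A. \<forall>w\<in>{1..n} - W. {u, w} \<notin> E)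
    \<or> (\<exists>v\<in>{1..n}. {1..n} - {v} \<noteq> {} \<and>
          real n / 4 \<le> real (card (posa_set ({1..n} - {v}) {e \<in> E. v \<notin> e})) \<and>
          (\<forall>u\<in>posa_set ({1..n} - {v}) {e \<in> E. v \<notin> e}. {u, v} \<notin> E))"
proof -
  obtain v where v: "v \<in> {1..n}" "{1..n} - {v} \<noteq> {}"
    "\<And>u. u \<in> posa_set ({1..n} - {v}) {e \<in> E. v \<notin> e} \<Longrightarrow> {u, v} \<notin> E"
  proof (rule missed_vertex_not_adjacent_posa_set[of "{1..n}" E])
    show "set P \<noteq> {1..n}" if "path_in {1..n} E P" for P
      using that assms(2) E_HAM_iff[OF assms(1)] by (auto simp: E_def)
  qed (use assms(1) in auto)
  define U where "U = posa_set ({1..n} - {v}) {e \<in> E. v \<notin> e}"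
  define N where "N = {y \<in> {1..n} - {v} - U. \<exists>u\<in>U. {u, y} \<in> {e \<in> E. v \<notin> e}}"
  have "finite ({1..n} - {v})" by simp
  note posa = posa_set[OF this v(2), where E = "{e \<in> E. v \<notin> e}", folded U_def, folded N_def]
  have finU: "finite U" using posa(1) finite_subset by blast
  show ?thesis
  proof (cases "4 * card U \<le> n")
    case True
    have "card (insert v (U \<union> N)) \<le> Suc (card U + card N)"
      using card_Un_le[of U N] by (intro card_insert_le_m1) auto
    also have "\<dots> \<le> 3 * card U" using posa(4) by simp
    finally have "card (insert v (U \<union> N)) \<le> 3 * card U" .
    moreover have "insert v (U \<union> N) \<subseteq> {1..n}"
      using v(1) posa(1) by (auto simp: N_def)
    ultimately obtain W where W: "insert v (U \<union> N) \<subseteq> W" "W \<subseteq> {1..n}" "card W = 3 * card U"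
      using exists_subset_between[of "insert v (U \<union> N)" "3 * card U" "{1..n}"] True by auto
    have "{u, w} \<notin> E" if "u \<in> U" "w \<in> {1..n} - W" for u w
    proof
      assume "{u, w} \<in> E"
      hence "w \<in> N" using that W(1) posa(1) by (auto simp: N_def)
      thus False using that W(1) by auto
    qed
    moreover have "(U, W) \<in> expansion_pairs n (card U)"
      using W by (auto simp: expansion_pairs_def)
    moreover have "card U \<in> {1..n div 4}"
      using True posa(2) finU by (auto simp: Suc_le_eq card_gt_0_iff)
    ultimately show ?thesis by blast
  next
    case False
    hence "real n / 4 \<le> real (card U)" by simp
    thus ?thesis using v unfolding U_def by blast
  qed
qed

text \<open>
  With \<open>x = exp (- c1 n q / 4)\<close>, the poorly expanding sets of size \<open>a\<close> contribute at most
  \<open>n\<^sup>4\<^sup>a x\<^sup>a\<close> to the union bound. Since \<open>n\<^sup>4 x \<le> 1\<close>, this is at most \<open>n\<^sup>4 x\<close> for each of the fewer than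
  \<open>n\<close> values of \<open>a\<close>. The \<open>n\<close> choices of a missed vertex contribute \<open>x\<close> each.
\<close>

lemma prob_not_hamiltonian_le:
  assumes p: "edge_prob_assignment n p" "good_assignment n \<alpha> c1 c2 q p"
    and pos: "c1 > 0" "q > 0" "n \<ge> 1" and \<alpha>: "\<alpha> \<le> 1 / 4"
    and small: "real n ^ 4 * exp (- (c1 * real n * q / 4)) \<le> 1"
  shows "measure_pmf.prob (edge_indicators n p) (- E_HAM n)
           \<le> 2 * real n ^ 5 * exp (- (c1 * real n * q / 4))"
proof -
  let ?P = "measure_pmf.prob (edge_indicators n p)"
  define x where "x = exp (- (c1 * real n * q / 4))"
  define no_edges where
    "no_edges = (\<lambda>(A, W). {Z. \<forall>u\<in>A. \<forall>w\<in>{1..n} - W. {u, w} \<notin> graph_edges n Z})"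
  \<comment> \<open>On an empty vertex set there is no path and \<open>posa_set\<close> is unspecified; the empty set makes
    \<open>U v E\<close> a set of vertices in every case.\<close>
  define U where "U v E = (if {1..n} - {v} = {} then {} else posa_set ({1..n} - {v}) E)"
    for v :: nat and E
  define missed where "missed v = {Z. real n / 4 \<le> real (card (U v {e \<in> graph_edges n Z. v \<notin> e})) \<and>
      (\<forall>u\<in>U v {e \<in> graph_edges n Z. v \<notin> e}. {u, v} \<notin> graph_edges n Z)}" for v
  have U_sub: "U v E \<subseteq> {1..n} - {v}" for v E
    using posa_set(1)[of "{1..n} - {v}" E] by (simp add: U_def)
  have \<alpha>n: "\<alpha> * real n \<le> real n / 4"
    using mult_right_mono[OF \<alpha>, of "real n"] by simp
  have one_pair: "?P (no_edges AW) \<le> x ^ a" if a: "a \<in> {1..n div 4}" "AW \<in> expansion_pairs n a" for a AW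
  proof -
    obtain A W where AW: "AW = (A, W)" "A \<subseteq> W" "W \<subseteq> {1..n}" "card A = a" "card W = 3 * a"
      using a(2) by (auto simp: expansion_pairs_def)
    have "4 * a \<le> n" using a(1) by auto
    have "card ({1..n} - W) = n - 3 * a"
      using AW by (subst card_Diff_subset) (auto intro: finite_subset)
    hence B: "real n / 4 \<le> real (card ({1..n} - W))"
      using \<open>4 * a \<le> n\<close> by simp
    moreover have "real n > 0" using pos(3) by simp
    ultimately have "real (card ({1..n} - W)) > 0" by linarith
    hence "{1..n} - W \<noteq> {}" by (metis card.empty less_irrefl of_nat_0)
    hence "?P (no_edges AW) \<le> exp (- (c1 * real a * real (card ({1..n} - W)) * q))"
      unfolding no_edges_def AW(1) prod.case
      using prob_no_edge_between_le[OF p, of A "{1..n} - W"] AW B \<alpha>n by auto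
    also have "\<dots> \<le> exp (- (c1 * real a * (real n / 4) * q))"
      using B pos by (simp add: mult_left_mono mult_right_mono)
    also have "\<dots> = x ^ a"
      by (simp add: x_def mult_ac flip: exp_of_nat_mult)
    finally show ?thesis .
  qed
  have size_a: "?P (\<Union>AW\<in>expansion_pairs n a. no_edges AW) \<le> real n ^ 4 * x"
    if a: "a \<in> {1..n div 4}" for a
  proof -
    have "?P (\<Union>AW\<in>expansion_pairs n a. no_edges AW) \<le> (\<Sum>AW\<in>expansion_pairs n a. ?P (no_edges AW))"
      by (intro measure_UNION_le finite_expansion_pairs) auto
    also have "\<dots> \<le> (\<Sum>AW\<in>expansion_pairs n a. x ^ a)"
      using one_pair a by (intro sum_mono) auto
    also have "\<dots> = real (card (expansion_pairs n a)) * x ^ a" by simp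
    also have "\<dots> \<le> real (n ^ (4 * a)) * x ^ a"
      using card_expansion_pairs_le[of n a] a pos(3)
      by (intro mult_right_mono of_nat_mono) (auto simp: x_def)
    also have "\<dots> = (real n ^ 4 * x) ^ a"
      by (simp add: power_mult power_mult_distrib)
    also have "\<dots> \<le> (real n ^ 4 * x) ^ 1"
      using small a by (intro power_decreasing) (auto simp: x_def)
    finally show ?thesis by simp
  qed
  have miss: "?P (missed v) \<le> x" if "v \<in> {1..n}" for v
    using prob_no_edge_to_revealed_set_le[OF p pos(1,2) that, of "U v" "real n / 4"] U_sub \<alpha>n pos(3)
    by (simp add: missed_def x_def)
  have "- E_HAM n \<subseteq> (\<Union>a\<in>{1..n div 4}. \<Union>AW\<in>expansion_pairs n a. no_edges AW) \<union> (\<Union>v\<in>{1..n}. missed v)"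
  proof
    fix Z assume "Z \<in> - E_HAM n"
    hence "Z \<notin> E_HAM n" by simp
    from non_hamiltonian_cases[OF pos(3) this]
    show "Z \<in> (\<Union>a\<in>{1..n div 4}. \<Union>AW\<in>expansion_pairs n a. no_edges AW) \<union> (\<Union>v\<in>{1..n}. missed v)"
      (is "_ \<in> ?L \<union> ?R")
    proof
      assume "\<exists>a\<in>{1..n div 4}. \<exists>(A, W)\<in>expansion_pairs n a.
        \<forall>u\<in>A. \<forall>w\<in>{1..n} - W. {u, w} \<notin> graph_edges n Z"
      then obtain a A W where "a \<in> {1..n div 4}" "(A, W) \<in> expansion_pairs n a"
        "Z \<in> no_edges (A, W)"
        unfolding no_edges_def by blast
      hence "Z \<in> ?L" by blast
      thus ?thesis ..
    next
      assume "\<exists>v\<in>{1..n}. {1..n} - {v} \<noteq> {} \<and>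
          real n / 4 \<le> real (card (posa_set ({1..n} - {v}) {e \<in> graph_edges n Z. v \<notin> e})) \<and>
          (\<forall>u\<in>posa_set ({1..n} - {v}) {e \<in> graph_edges n Z. v \<notin> e}. {u, v} \<notin> graph_edges n Z)"
      then obtain v where v: "v \<in> {1..n}" "{1..n} - {v} \<noteq> {}"
        "real n / 4 \<le> real (card (posa_set ({1..n} - {v}) {e \<in> graph_edges n Z. v \<notin> e}))"
        "\<forall>u\<in>posa_set ({1..n} - {v}) {e \<in> graph_edges n Z. v \<notin> e}. {u, v} \<notin> graph_edges n Z"
        by blast
      have "U v E = posa_set ({1..n} - {v}) E" for E
        unfolding U_def using v(2) by (rule if_not_P)
      hence "Z \<in> missed v"
        unfolding missed_def using v(3,4) by simp
      thus ?thesis using v(1) by blast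
    qed
  qed
  hence "?P (- E_HAM n) \<le> ?P ((\<Union>a\<in>{1..n div 4}. \<Union>AW\<in>expansion_pairs n a. no_edges AW) \<union> (\<Union>v\<in>{1..n}. missed v))"
    by (intro measure_pmf.finite_measure_mono) auto
  also have "\<dots> \<le> ?P (\<Union>a\<in>{1..n div 4}. \<Union>AW\<in>expansion_pairs n a. no_edges AW) + ?P (\<Union>v\<in>{1..n}. missed v)"
    by (intro measure_Un_le) auto
  also have "?P (\<Union>a\<in>{1..n div 4}. \<Union>AW\<in>expansion_pairs n a. no_edges AW)
      \<le> (\<Sum>a\<in>{1..n div 4}. ?P (\<Union>AW\<in>expansion_pairs n a. no_edges AW))"
    by (intro measure_UNION_le) auto
  also have "\<dots> \<le> (\<Sum>a\<in>{1..n div 4}. real n ^ 4 * x)"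
    using size_a by (rule sum_mono)
  also have "\<dots> = real (n div 4) * (real n ^ 4 * x)" by simp
  also have "\<dots> \<le> real n * (real n ^ 4 * x)"
    by (intro mult_right_mono) (auto simp: x_def)
  also have "?P (\<Union>v\<in>{1..n}. missed v) \<le> (\<Sum>v\<in>{1..n}. ?P (missed v))"
    by (intro measure_UNION_le) auto
  also have "\<dots> \<le> (\<Sum>v\<in>{1..n}. x)"
    using miss by (rule sum_mono)
  also have "\<dots> = real n * (1 * x)" by simp
  also have "\<dots> \<le> real n * (real n ^ 4 * x)"
    using pos(3) by (intro mult_left_mono mult_right_mono) (auto simp: x_def)
  finally show ?thesis
    by (simp add: x_def eval_nat_numeral algebra_simps)
qed

section \<open>Constants and asymptotics\<close>

text \<open>
  The upper and the lower bound of goodness are compatible for a single set only if \<open>c1 \<le> c2\<close>;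
  the set of all vertices but the first serves for this.
\<close>

lemma good_assignment_c1_le_c2:
  assumes "good_assignment n \<alpha> c1 c2 q p" "n \<ge> 2" "q > 0" "\<alpha> * real n \<le> real n - 1"
  shows "c1 \<le> c2"
proof -
  have card: "real (card {2..n}) = real n - 1"
    using assms(2) by (simp add: of_nat_diff)
  have "\<alpha> * real n \<le> real (card {2..n})"
    unfolding card by (rule assms(4))
  moreover have "1 \<le> card {2..n}" "{2..n} \<subseteq> {1..n} - {1}" "1 \<in> {1..n}"
    using assms(2) by auto
  ultimately have "c1 * real (card {2..n}) * q \<le> (\<Sum>v\<in>{2..n}. p 1 v)"
    "(\<Sum>v\<in>{2..n}. p 1 v) \<le> c2 * real (card {2..n}) * q"
    using assms(1) unfolding good_assignment_def by blast+
  hence "c1 * (real (card {2..n}) * q) \<le> c2 * (real (card {2..n}) * q)"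
    by (simp only: mult.assoc)
  moreover have "real (card {2..n}) * q > 0"
    using assms(2,3) by simp
  ultimately show ?thesis by (rule mult_right_le_imp_le)
qed

lemma eventually_poly_le_exp_root:
  fixes c :: real
  assumes "c > 0"
  shows "\<forall>\<^sub>F n in sequentially. 2 * real n ^ 5 \<le> exp (c * real n powr (1 / real (k + 1)))"
proof -
  \<comment> \<open>This exponent makes the \<open>m\<close>-th power of the argument of \<open>exp\<close> equal to \<open>c ^ m * n ^ 5\<close>.\<close>
  define m where "m = 5 * (k + 1)"
  have lim: "filterlim (\<lambda>n. exp (1 / real (k + 1) * ln (real n))) at_top sequentially"
    by (intro filterlim_compose[OF exp_at_top] filterlim_tendsto_pos_mult_at_top[OF tendsto_const]
        filterlim_compose[OF ln_at_top] filterlim_real_sequentially) auto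
  have "\<forall>\<^sub>F n in sequentially. exp (1 / real (k + 1) * ln (real n)) = real n powr (1 / real (k + 1))"
    using eventually_gt_at_top[of 0] by eventually_elim (simp add: powr_def)
  from iffD1[OF filterlim_cong[OF refl refl this] lim]
  have "filterlim (\<lambda>n. c * real n powr (1 / real (k + 1))) at_top sequentially"
    by (rule filterlim_tendsto_pos_mult_at_top[OF tendsto_const assms])
  from filterlim_compose[OF tendsto_power_div_exp_0 this]
  have "((\<lambda>n. (c * real n powr (1 / real (k + 1))) ^ m / exp (c * real n powr (1 / real (k + 1))))
      \<longlongrightarrow> 0) sequentially" .
  hence "\<forall>\<^sub>F n in sequentially. (c * real n powr (1 / real (k + 1))) ^ m /
      exp (c * real n powr (1 / real (k + 1))) < c ^ m / 2"
    using assms by (intro order_tendstoD) auto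
  thus ?thesis
    using eventually_gt_at_top[of 0]
  proof eventually_elim
    case (elim n)
    have "(real n powr (1 / real (k + 1))) ^ m = (real n powr (1 / real (k + 1))) powr real m"
      using elim(2) by (intro powr_realpow[symmetric]) simp
    also have "\<dots> = real n powr real 5"
    proof -
      have "1 / real (k + 1) * real m = real 5"
        unfolding m_def of_nat_mult by (simp del: of_nat_add of_nat_Suc)
      thus ?thesis by (simp only: powr_powr)
    qed
    also have "\<dots> = real n ^ 5"
      using elim(2) by (subst powr_realpow) auto
    finally have "c ^ m * real n ^ 5 < c ^ m / 2 * exp (c * real n powr (1 / real (k + 1)))"
      using elim(1) by (simp add: power_mult_distrib divide_less_eq)
    hence "c ^ m * (2 * real n ^ 5) < c ^ m * exp (c * real n powr (1 / real (k + 1)))"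
      by simp
    thus ?case using assms by simp
  qed
qed

section \<open>Hamiltonian paths exist with high probability\<close>

theorem theorem1:
  fixes \<alpha> c1 c2 C :: real and k :: nat and pn :: "nat \<Rightarrow> real"
  assumes "0 < \<alpha>" and "\<alpha> < 1" and "c1 > 0" and "c2 > 0" and "C > 0" and "k \<ge> 1"
    and "C \<le> 1 / (10 * c2)"
    and "\<alpha> \<le> min (7 / 8) ((C * c1 / 8) ^ (k + 1))"
    and "\<And>n. pn n = C * real n powr (- (real k / real (k + 1)))"
  shows "\<exists>\<theta>>0. \<exists>n0::nat. \<forall>n\<ge>n0. \<forall>p :: nat \<Rightarrow> nat \<Rightarrow> real.
           edge_prob_assignment n p \<and> good_assignment n \<alpha> c1 c2 (pn n) p \<longrightarrow>
           measure_pmf.prob (edge_indicators n p) (E_HAM n) \<ge> 1 - exp (- \<theta> * real n * pn n)"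
proof -
  \<comment> \<open>The failure probability is at most \<open>2 n\<^sup>5 exp (- c1 n q / 4)\<close>; half of the exponent absorbs the
    polynomial factor and the other half remains.\<close>
  define \<theta> where "\<theta> = c1 / 8"
  have np: "real n * pn n = C * real n powr (1 / real (k + 1))" if "n \<ge> 1" for n
  proof -
    have "real n * real n powr (- (real k / real (k + 1)))
        = real n powr 1 * real n powr (- (real k / real (k + 1)))"
      using that by simp
    also have "\<dots> = real n powr (1 + - (real k / real (k + 1)))"
      by (rule powr_add[symmetric])
    also have "1 + - (real k / real (k + 1)) = 1 / real (k + 1)"
      by (simp add: field_simps)
    finally show ?thesis by (simp add: assms(9))
  qed
  have "\<theta> * C > 0" using assms by (simp add: \<theta>_def)
  from eventually_poly_le_exp_root[OF this, of k]
  obtain n1 where n1: "\<And>n. n \<ge> n1 \<Longrightarrow> 2 * real n ^ 5 \<le> exp (\<theta> * C * real n powr (1 / real (k + 1)))"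
    by (auto simp: eventually_sequentially)
  have main: "measure_pmf.prob (edge_indicators n p) (E_HAM n) \<ge> 1 - exp (- \<theta> * real n * pn n)"
    if n: "n \<ge> max 8 n1" and p: "edge_prob_assignment n p" "good_assignment n \<alpha> c1 c2 (pn n) p"
    for n p
  proof -
    define y where "y = \<theta> * (real n * pn n)"
    have n2: "n \<ge> 8" "n \<ge> n1" using n by auto
    have q: "pn n > 0" using n2 assms(5,9) by simp
    have y: "y > 0" "c1 * real n * pn n / 4 = 2 * y"
      using q n2 assms(3) by (simp_all add: y_def \<theta>_def)
    have "\<theta> * C * real n powr (1 / real (k + 1)) = y"
      using np[of n] n2 by (simp add: y_def)
    with n1[OF n2(2)] have poly: "2 * real n ^ 5 \<le> exp y" by simp
    \<comment> \<open>For \<open>n \<ge> 8\<close>, the bound \<open>\<alpha> \<le> 7 / 8\<close> lets goodness apply to sets of \<open>n - 1\<close> vertices.\<close>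
    have "\<alpha> * real n \<le> 7 / 8 * real n"
      using assms(8) by (intro mult_right_mono) auto
    also have "\<dots> \<le> real n - 1" using n2 by simp
    finally have "c1 \<le> c2"
      using good_assignment_c1_le_c2[OF p(2) _ q] n2 by simp
    hence "C * c1 \<le> C * c2" using assms(5) by simp
    also have "\<dots> \<le> 1 / (10 * c2) * c2"
      using assms(4,7) by (intro mult_right_mono) auto
    finally have "C * c1 / 8 \<le> 1 / 4" using assms(4) by simp
    moreover have "0 \<le> C * c1 / 8" using assms(3,5) by simp
    ultimately have "(C * c1 / 8) ^ (k + 1) \<le> C * c1 / 8"
      using power_decreasing[of 1 "k + 1" "C * c1 / 8"] by simp
    hence \<alpha>: "\<alpha> \<le> 1 / 4"
      using assms(8) \<open>C * c1 / 8 \<le> 1 / 4\<close> by simp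
    have bound: "2 * real n ^ 5 * exp (- (2 * y)) \<le> exp (- y)"
    proof -
      have "2 * real n ^ 5 * exp (- (2 * y)) \<le> exp y * exp (- (2 * y))"
        using poly by (intro mult_right_mono) auto
      also have "\<dots> = exp (- y)" by (simp flip: exp_add)
      finally show ?thesis .
    qed
    have "real n ^ 4 * 1 \<le> real n ^ 4 * (2 * real n)"
      using n2 by (intro mult_left_mono) auto
    hence "real n ^ 4 \<le> 2 * real n ^ 5"
      by (simp add: eval_nat_numeral algebra_simps)
    hence "real n ^ 4 * exp (- (2 * y)) \<le> 2 * real n ^ 5 * exp (- (2 * y))"
      by (intro mult_right_mono) auto
    also note bound
    also have "exp (- y) \<le> 1" using y by simp
    finally have "measure_pmf.prob (edge_indicators n p) (- E_HAM n) \<le> 2 * real n ^ 5 * exp (- (2 * y))"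
      using prob_not_hamiltonian_le[OF p assms(3) q _ \<alpha>] n2 unfolding y(2) by simp
    also note bound
    finally have "measure_pmf.prob (edge_indicators n p) (- E_HAM n) \<le> exp (- y)" .
    moreover have "measure_pmf.prob (edge_indicators n p) (- E_HAM n)
        = 1 - measure_pmf.prob (edge_indicators n p) (E_HAM n)"
      using measure_pmf.prob_compl[of "E_HAM n" "edge_indicators n p"] by (simp add: Compl_eq_Diff_UNIV)
    ultimately show ?thesis by (simp add: y_def mult.assoc)
  qed
  have "\<theta> > 0" using assms by (simp add: \<theta>_def)
  thus ?thesis using main by blast
qed

end
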